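(* Let $(X,d_X)$ be a starry metric space and $(Y,d_Y)$ be a doubling metric space. Then $X$ is not doubling, and any embedding $\phi\colon X\to Y$ cannot be quasisymmetric.
   Context: **Approximate stars.** Let $A>1$ and $0<\eta<1$ satisfy $A-\eta>1+\eta$ (equivalently $\eta<(A-1)/2$). A metric space $(X,d)$ contains an $(A,\eta)$-approximate $n$-star if there exist $\varrho>0$ and points $x_0,\dots,x_n\in X$ such that $(A-\eta)\varrho\le d(x_i,x_j)\le A\varrho$ for all $i,j\in\{1,\dots,n\}$ with $i\ne j$, and $\varrho\le d(x_0,x_i)\le(1+\eta)\varrho$ for all $i\in\{1,\dots,n\}$. **Starry.** $(X,d)$ is starry if there exist $A>1$ and $0<\eta<(A-1)/2$ (independent of $n$) such that for every $n\in\mathbb N$ there is $A_n\ge A$ for which $(X,d)$ contains an $(A_n,\eta)$-approximate $n$-star. **Doubling.** A metric space $X$ is doubling if there is a constant $K>0$ such that for all $x\in X$ and $r>0$ the closed ball $B(x,r)$ can be covered by at most $K$ balls of radius $r/2$. **Quasisymmetric.** An embedding $\phi\colon X\to Y$ (homeomorphism onto its image $\phi(X)$, with the metric $d_Y$) is quasisymmetric if there is an increasing function $\Psi\colon(0,\infty)\to(0,\infty)$ such that for any three distinct points $x,y,z\in X$, $$\frac{d_Y(\phi(x),\phi(y))}{d_Y(\phi(x),\phi(z))}\le\Psi\left(\frac{d_X(x,y)}{d_X(x,z)}\right).$$ *)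

theory Defs
  imports "HOL-Analysis.Analysis"
begin

text \<open>
  Metric spaces are elements of the library type \<open>'a metric\<close>, so that the carrier
  may be an arbitrary set. The constraints relating \<open>A\<close> and \<open>\<eta>\<close>, under which the notion of an
  approximate star is introduced, are made part of the predicate.
\<close>

definition approximate_star :: "'a metric \<Rightarrow> real \<Rightarrow> real \<Rightarrow> nat \<Rightarrow> bool" where
  "approximate_star X A \<eta> n \<longleftrightarrow>
     A > 1 \<and> 0 < \<eta> \<and> \<eta> < 1 \<and> A - \<eta> > 1 + \<eta> \<and>
     (\<exists>\<rho>>0. \<exists>x :: nat \<Rightarrow> 'a.
        (\<forall>i\<in>{0..n}. x i \<in> mspace X) \<and>
        (\<forall>i\<in>{1..n}. \<forall>j\<in>{1..n}. i \<noteq> j \<longrightarrow>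
           (A - \<eta>) * \<rho> \<le> mdist X (x i) (x j) \<and> mdist X (x i) (x j) \<le> A * \<rho>) \<and>
        (\<forall>i\<in>{1..n}. \<rho> \<le> mdist X (x 0) (x i) \<and> mdist X (x 0) (x i) \<le> (1 + \<eta>) * \<rho>))"

definition starry :: "'a metric \<Rightarrow> bool" where
  "starry X \<longleftrightarrow>
     (\<exists>A \<eta>. A > 1 \<and> 0 < \<eta> \<and> \<eta> < (A - 1) / 2 \<and>
        (\<forall>n. \<exists>A'\<ge>A. approximate_star X A' \<eta> n))"

text \<open>The covering balls are closed and have their centres in the space.\<close>

definition doubling :: "'a metric \<Rightarrow> bool" where
  "doubling X \<longleftrightarrow>
     (\<exists>K::nat. K > 0 \<and>
        (\<forall>x\<in>mspace X. \<forall>r>0. \<exists>C. C \<subseteq> mspace X \<and> finite C \<and> card C \<le> K \<and>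
           mcball_of X x r \<subseteq> (\<Union>c\<in>C. mcball_of X c (r / 2))))"

text \<open>
  The distortion condition alone; it is meant for topological embeddings \<open>\<phi>\<close>, in the sense of
  \<^const>\<open>embedding_map\<close>. Only the values of \<open>\<Psi>\<close> on positive reals matter, and
  increasing is understood in the weak sense.
\<close>

definition quasisymmetric :: "'a metric \<Rightarrow> 'b metric \<Rightarrow> ('a \<Rightarrow> 'b) \<Rightarrow> bool" where
  "quasisymmetric X Y \<phi> \<longleftrightarrow>
     (\<exists>\<Psi> :: real \<Rightarrow> real.
        mono_on {0<..} \<Psi> \<and> (\<forall>t>0. \<Psi> t > 0) \<and>
        (\<forall>x\<in>mspace X. \<forall>y\<in>mspace X. \<forall>z\<in>mspace X.
           x \<noteq> y \<and> x \<noteq> z \<and> y \<noteq> z \<longrightarrow>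
           mdist Y (\<phi> x) (\<phi> y) / mdist Y (\<phi> x) (\<phi> z) \<le> \<Psi> (mdist X x y / mdist X x z)))"

end

theory Submission
  imports Defs
begin

text \<open>
  Quasisymmetry carries the separation of an approximate star, relative to its radius, over to the
  image, with constants not depending on the number of points; doubling bounds the size of a
  separated set in a ball. Since the identity is quasisymmetric, non-doubling of \<open>X\<close> is the case
  \<open>Y = X\<close>.
\<close>

text \<open>Each of the at most \<open>K ^ k\<close> balls of radius \<open>r / 2 ^ k\<close> is in
  turn covered by at most \<open>K\<close> balls of half that radius, and a union bound counts the
  new centres. \<open>K\<close> is fixed before \<open>k\<close>, \<open>x\<close> and
  \<open>r\<close>, so it serves at every scale and depth.\<close>

lemma doubling_iterated:
  assumes "doubling X"
  obtains K :: nat where "\<And>k x r. x \<in> mspace X \<Longrightarrow> r > 0 \<Longrightarrow>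
    \<exists>C. C \<subseteq> mspace X \<and> finite C \<and> card C \<le> K ^ k \<and> mcball_of X x r \<subseteq> (\<Union>c\<in>C. mcball_of X c (r / 2 ^ k))"
proof -
  obtain K :: nat where K: "\<And>x r. x \<in> mspace X \<Longrightarrow> r > 0 \<Longrightarrow>
    \<exists>C. C \<subseteq> mspace X \<and> finite C \<and> card C \<le> K \<and> mcball_of X x r \<subseteq> (\<Union>c\<in>C. mcball_of X c (r / 2))"
    using assms unfolding doubling_def by metis
  have "\<exists>C. C \<subseteq> mspace X \<and> finite C \<and> card C \<le> K ^ k \<and> mcball_of X x r \<subseteq> (\<Union>c\<in>C. mcball_of X c (r / 2 ^ k))"
    if x: "x \<in> mspace X" and r: "r > 0" for k x r
  proof (induction k)
    case 0
    show ?case using x by (intro exI[of _ "{x}"]) auto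
  next
    case (Suc k)
    then obtain C where C: "C \<subseteq> mspace X" "finite C" "card C \<le> K ^ k"
      "mcball_of X x r \<subseteq> (\<Union>c\<in>C. mcball_of X c (r / 2 ^ k))" by blast
    have "\<forall>c\<in>C. \<exists>D. D \<subseteq> mspace X \<and> finite D \<and> card D \<le> K \<and>
        mcball_of X c (r / 2 ^ k) \<subseteq> (\<Union>d\<in>D. mcball_of X d (r / 2 ^ k / 2))"
      using C(1) r by (intro ballI K) auto
    then obtain D where D: "\<And>c. c \<in> C \<Longrightarrow> D c \<subseteq> mspace X \<and> finite (D c) \<and> card (D c) \<le> K \<and>
        mcball_of X c (r / 2 ^ k) \<subseteq> (\<Union>d\<in>D c. mcball_of X d (r / 2 ^ k / 2))"
      by metis
    have "card (\<Union>c\<in>C. D c) \<le> (\<Sum>c\<in>C. card (D c))"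
      using C(2) by (rule card_UN_le)
    also have "\<dots> \<le> card C * K"
      using D by (metis sum_bounded_above of_nat_id)
    also have "\<dots> \<le> K ^ Suc k"
      using C(3) by (simp add: mult.commute)
    finally have card: "card (\<Union>c\<in>C. D c) \<le> K ^ Suc k" .
    have half: "r / 2 ^ k / 2 = r / 2 ^ Suc k" by simp
    have cover: "mcball_of X x r \<subseteq> (\<Union>d\<in>(\<Union>c\<in>C. D c). mcball_of X d (r / 2 ^ Suc k))"
    proof
      fix y assume "y \<in> mcball_of X x r"
      then obtain c where "c \<in> C" "y \<in> mcball_of X c (r / 2 ^ k)" using C(4) by blast
      then show "y \<in> (\<Union>d\<in>(\<Union>c\<in>C. D c). mcball_of X d (r / 2 ^ Suc k))"
        using D[of c] unfolding half by blast
    qed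
    show ?case
      using C(2) D by (intro exI[of _ "\<Union>c\<in>C. D c"] conjI card cover) blast+
  qed
  then show ?thesis using that by blast
qed

text \<open>Pigeonhole: at most \<open>K ^ k\<close> balls of radius \<open>r / 2 ^ k\<close> cover
  the large ball, and by the triangle inequality none of them holds two of the separated points.
  \<open>N\<close> depends on \<open>k\<close> but not on the centre or the radius, so it can be
  fixed before a star is chosen. With an indexed family of points, the number bounded is directly
  \<open>card I\<close>.\<close>

lemma doubling_separated_bound:
  assumes "doubling X"
  obtains N :: nat where "\<And>x r p I. x \<in> mspace X \<Longrightarrow> r > 0 \<Longrightarrow> finite I \<Longrightarrow> p ` I \<subseteq> mcball_of X x r \<Longrightarrow>
    (\<And>i j. i \<in> I \<Longrightarrow> j \<in> I \<Longrightarrow> i \<noteq> j \<Longrightarrow> mdist X (p i) (p j) > 2 * r / 2 ^ k) \<Longrightarrow> card I \<le> N"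
proof -
  obtain K :: nat where K: "\<And>k x r. x \<in> mspace X \<Longrightarrow> r > 0 \<Longrightarrow>
    \<exists>C. C \<subseteq> mspace X \<and> finite C \<and> card C \<le> K ^ k \<and> mcball_of X x r \<subseteq> (\<Union>c\<in>C. mcball_of X c (r / 2 ^ k))"
    using doubling_iterated[OF assms] by blast
  show thesis
  proof (rule that[of "K ^ k"])
    fix x r p and I :: "'c set"
    assume x: "x \<in> mspace X" "r > 0" and I: "finite I" "p ` I \<subseteq> mcball_of X x r"
      and sep: "\<And>i j. i \<in> I \<Longrightarrow> j \<in> I \<Longrightarrow> i \<noteq> j \<Longrightarrow> mdist X (p i) (p j) > 2 * r / 2 ^ k"
    obtain C where C: "finite C" "card C \<le> K ^ k"
      "mcball_of X x r \<subseteq> (\<Union>c\<in>C. mcball_of X c (r / 2 ^ k))"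
      using K[OF x] by blast
    have "\<forall>i\<in>I. \<exists>c\<in>C. p i \<in> mcball_of X c (r / 2 ^ k)"
      using I(2) C(3) by blast
    then obtain c where c: "\<And>i. i \<in> I \<Longrightarrow> c i \<in> C \<and> p i \<in> mcball_of X (c i) (r / 2 ^ k)"
      by metis
    \<comment> \<open>\<open>c\<close> selects for each index a small ball containing its point; two
      indices with the same ball would have points at distance at most
      \<open>2 * r / 2 ^ k\<close>.\<close>
    have "inj_on c I"
    proof (rule inj_onI, rule ccontr)
      fix i j assume ij: "i \<in> I" "j \<in> I" "c i = c j" "i \<noteq> j"
      have "mdist X (p i) (p j) \<le> mdist X (c i) (p i) + mdist X (c i) (p j)"
        using c[OF ij(1)] c[OF ij(2)] ij(3)
        by (metis in_mcball_of mdist_commute mdist_triangle)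
      also have "\<dots> \<le> 2 * r / 2 ^ k"
        using c[OF ij(1)] c[OF ij(2)] ij(3) by auto
      finally show False using sep[OF ij(1,2,4)] by simp
    qed
    then have "card I \<le> card C"
      using c C(1) by (intro card_inj_on_le) auto
    then show "card I \<le> K ^ k" using C(2) by simp
  qed
qed

lemma mdist_self: "x \<in> mspace X \<Longrightarrow> mdist X x x = 0"
  by simp

lemma mdist_pos_less: "x \<in> mspace X \<Longrightarrow> y \<in> mspace X \<Longrightarrow> x \<noteq> y \<Longrightarrow> mdist X x y > 0"
  by (simp add: order_less_le eq_commute[of 0])

text \<open>Stated for injections into \<open>mspace Y\<close>, so that the identity of a space and
  topological embeddings are both instances.\<close>

lemma starry_quasisymmetric_imp_not_doubling:
  assumes "starry X" and inj: "inj_on \<phi> (mspace X)" and im: "\<phi> ` mspace X \<subseteq> mspace Y"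
    and "quasisymmetric X Y \<phi>"
  shows "\<not> doubling Y"
proof
  assume dbl: "doubling Y"
  obtain \<Psi> where mono: "mono_on {0<..} \<Psi>" and pos: "\<And>t. t > 0 \<Longrightarrow> \<Psi> t > 0"
    and qs: "\<And>x y z. x \<in> mspace X \<Longrightarrow> y \<in> mspace X \<Longrightarrow> z \<in> mspace X \<Longrightarrow> x \<noteq> y \<Longrightarrow> x \<noteq> z \<Longrightarrow> y \<noteq> z \<Longrightarrow>
           mdist Y (\<phi> x) (\<phi> y) / mdist Y (\<phi> x) (\<phi> z) \<le> \<Psi> (mdist X x y / mdist X x z)"
    using \<open>quasisymmetric X Y \<phi>\<close> unfolding quasisymmetric_def by (metis (no_types))
  \<comment> \<open>In a star all legs lie between \<rho> and 2\<rho>, because \<eta> < 1, and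
    distinct tips are at least \<rho> apart, because A - \<eta> > 1. Every ratio compared below is
    thus at most 2, and one value of \<Psi> suffices.\<close>
  define L where "L = \<Psi> 2"
  have L: "L > 0" using pos by (simp add: L_def)
  have distort: "mdist Y (\<phi> x) (\<phi> y) \<le> L * mdist Y (\<phi> x) (\<phi> z)"
    if xyz: "x \<in> mspace X" "y \<in> mspace X" "z \<in> mspace X" "x \<noteq> y" "x \<noteq> z" "y \<noteq> z"
      and le: "mdist X x y \<le> 2 * mdist X x z" for x y z
  proof -
    have d: "mdist X x y > 0" "mdist X x z > 0"
      using xyz by (auto intro: mdist_pos_less)
    \<comment> \<open>A zero denominator would make the quotient 0 and its bound uninformative;
      injectivity excludes this.\<close>
    have "\<phi> x \<noteq> \<phi> z" using inj xyz by (auto dest: inj_onD)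
    then have "mdist Y (\<phi> x) (\<phi> z) > 0"
      using im xyz by (auto intro!: mdist_pos_less)
    moreover have "\<Psi> (mdist X x y / mdist X x z) \<le> L"
      unfolding L_def using d le by (intro mono_onD[OF mono]) (auto simp: field_simps)
    ultimately show ?thesis
      using order_trans[OF qs[OF xyz]] by (simp add: pos_divide_le_eq)
  qed
  \<comment> \<open>The image tips will lie in a ball of radius \<open>L * s\<close> with mutual
    distances at least \<open>s / L ^ 2\<close>. This choice makes \<open>s / L ^ 2\<close> exceed
    \<open>2 * (L * s) / 2 ^ k\<close>. It depends only on \<Psi>, so \<open>N\<close> is known
    before the star.\<close>
  obtain k :: nat where k: "2 * L ^ 3 < 2 ^ k"
    using real_arch_pow[of 2] by auto
  obtain N :: nat where N: "\<And>x r p (I :: nat set). x \<in> mspace Y \<Longrightarrow> r > 0 \<Longrightarrow> finite I \<Longrightarrow>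
    p ` I \<subseteq> mcball_of Y x r \<Longrightarrow>
    (\<And>i j. i \<in> I \<Longrightarrow> j \<in> I \<Longrightarrow> i \<noteq> j \<Longrightarrow> mdist Y (p i) (p j) > 2 * r / 2 ^ k) \<Longrightarrow> card I \<le> N"
    using doubling_separated_bound[OF dbl] by blast
  \<comment> \<open>Tip 1 is reserved as a reference; the tips 2 to N + 2 remain, which is one more
    than \<open>N\<close> allows.\<close>
  obtain A \<eta> where star: "approximate_star X A \<eta> (N + 2)"
    using \<open>starry X\<close> unfolding starry_def by blast
  then have A: "\<eta> > 0" "\<eta> < 1" "A - \<eta> > 1 + \<eta>" by (auto simp: approximate_star_def)
  obtain \<rho> and x :: "nat \<Rightarrow> 'a" where \<rho>: "\<rho> > 0"
    and x_in: "\<forall>i\<in>{0..N+2}. x i \<in> mspace X"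
    and tips: "\<forall>i\<in>{1..N+2}. \<forall>j\<in>{1..N+2}. i \<noteq> j \<longrightarrow>
      (A - \<eta>) * \<rho> \<le> mdist X (x i) (x j) \<and> mdist X (x i) (x j) \<le> A * \<rho>"
    and legs: "\<forall>i\<in>{1..N+2}. \<rho> \<le> mdist X (x 0) (x i) \<and> mdist X (x 0) (x i) \<le> (1 + \<eta>) * \<rho>"
    using star unfolding approximate_star_def by blast
  have xX: "x i \<in> mspace X" if "i \<le> N + 2" for i
    using x_in that by simp
  have legs2: "mdist X (x 0) (x i) \<le> 2 * \<rho>" if "i \<in> {1..N+2}" for i
    using bspec[OF legs that] mult_right_mono[of "1 + \<eta>" 2 \<rho>] A \<rho> by linarith
  have tips1: "mdist X (x i) (x j) \<ge> \<rho>" if "i \<in> {1..N+2}" "j \<in> {1..N+2}" "i \<noteq> j" for i j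
    using bspec[OF bspec[OF tips that(1)] that(2)] that(3) mult_right_mono[of 1 "A - \<eta>" \<rho>] A \<rho> by linarith
  have x0: "x 0 \<noteq> x i" if "i \<in> {1..N+2}" for i
    using bspec[OF legs that] \<rho> xX[of 0] by (auto simp: mdist_self)
  have xij: "x i \<noteq> x j" if "i \<in> {1..N+2}" "j \<in> {1..N+2}" "i \<noteq> j" for i j
    using tips1[OF that] \<rho> xX[of j] that by (auto simp: mdist_self)
  \<comment> \<open>The image of the first leg sets the scale in \<open>Y\<close>, where the star
    has no prescribed radius.\<close>
  define s where "s = mdist Y (\<phi> (x 0)) (\<phi> (x 1))"
  have s: "s > 0"
    unfolding s_def using x0[of 1] xX[of 0] xX[of 1] im inj
    by (auto intro!: mdist_pos_less dest: inj_onD)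
  \<comment> \<open>Seen from the centre, leg i and leg 1 are compared in both directions
    (\<open>radius\<close>, \<open>inner\<close>); seen from tip i, its leg is compared with the
    distance to another tip (\<open>outer\<close>). Index 1 is left out because
    \<open>distort\<close> needs three distinct points.\<close>
  have radius: "mdist Y (\<phi> (x 0)) (\<phi> (x i)) \<le> L * s" if "i \<in> {2..N+2}" for i
    unfolding s_def using that x0[of i] x0[of 1] xij[of i 1] legs2[of i] bspec[OF legs, of 1]
    by (intro distort xX) auto
  have inner: "s \<le> L * mdist Y (\<phi> (x 0)) (\<phi> (x i))" if "i \<in> {2..N+2}" for i
    unfolding s_def using that x0[of i] x0[of 1] xij[of 1 i] legs2[of 1] bspec[OF legs, of i]
    by (intro distort xX) auto
  have outer: "mdist Y (\<phi> (x 0)) (\<phi> (x i)) \<le> L * mdist Y (\<phi> (x i)) (\<phi> (x j))"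
    if "i \<in> {2..N+2}" "j \<in> {2..N+2}" "i \<noteq> j" for i j
  proof -
    have "mdist Y (\<phi> (x i)) (\<phi> (x 0)) \<le> L * mdist Y (\<phi> (x i)) (\<phi> (x j))"
      using that x0[of i] x0[of j] xij[of i j] legs2[of i] tips1[of i j]
      by (intro distort xX) (auto simp: mdist_commute)
    then show ?thesis by (simp add: mdist_commute)
  qed
  have "card {2..N+2} \<le> N"
  proof (rule N[of "\<phi> (x 0)" "L * s" _ "\<lambda>i. \<phi> (x i)"])
    show "\<phi> (x 0) \<in> mspace Y" using xX[of 0] im by auto
    show "L * s > 0" using L s by simp
    show "(\<lambda>i. \<phi> (x i)) ` {2..N+2} \<subseteq> mcball_of Y (\<phi> (x 0)) (L * s)"
      using radius xX im by (auto simp: image_subset_iff)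
    fix i j assume ij: "i \<in> {2..N+2}" "j \<in> {2..N+2}" "i \<noteq> j"
    define m where "m = mdist Y (\<phi> (x i)) (\<phi> (x j))"
    \<comment> \<open>Chaining \<open>inner\<close> and \<open>outer\<close> gives the lower bound
      on the separation, and also \<open>m > 0\<close>, which the strict inequality below
      requires.\<close>
    have "s \<le> L * (L * m)"
      using inner[OF ij(1)] mult_left_mono[OF outer[OF ij], of L] L unfolding m_def by linarith
    then have "L * (L * m) > 0" using s by linarith
    then have "m > 0" using L by (simp add: zero_less_mult_iff)
    have "2 * (L * s) \<le> 2 * L ^ 3 * m"
      using mult_left_mono[OF \<open>s \<le> L * (L * m)\<close>, of L] L by (simp add: power3_eq_cube mult_ac)
    also have "\<dots> < 2 ^ k * m"
      using k \<open>m > 0\<close> by simp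
    finally show "mdist Y (\<phi> (x i)) (\<phi> (x j)) > 2 * (L * s) / 2 ^ k"
      by (simp add: m_def field_simps)
  qed simp
  then show False by simp
qed

lemma quasisymmetric_ident: "quasisymmetric X X (\<lambda>x. x)"
  unfolding quasisymmetric_def by (intro exI[of _ "\<lambda>t. t"]) (auto intro: mono_onI)

theorem corollary2p5:
  fixes X :: "'a metric" and Y :: "'b metric"
  assumes "starry X" and "doubling Y"
  shows "\<not> doubling X \<and>
    (\<forall>\<phi>. embedding_map (mtopology_of X) (mtopology_of Y) \<phi> \<longrightarrow> \<not> quasisymmetric X Y \<phi>)"
proof (intro conjI allI impI notI)
  assume "doubling X"
  then show False
    using starry_quasisymmetric_imp_not_doubling[OF \<open>starry X\<close> _ _ quasisymmetric_ident] by simp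
next
  fix \<phi> assume emb: "embedding_map (mtopology_of X) (mtopology_of Y) \<phi>" and qs: "quasisymmetric X Y \<phi>"
  have "homeomorphic_map (mtopology_of X) (subtopology (mtopology_of Y) (\<phi> ` mspace X)) \<phi>"
    using emb by (simp add: embedding_map_def)
  \<comment> \<open>The second equation is surjectivity onto the topspace of the subtopology; it
    encodes that \<phi> maps into \<open>mspace Y\<close>.\<close>
  then have "inj_on \<phi> (mspace X)" "\<phi> ` mspace X = mspace Y \<inter> \<phi> ` mspace X"
    by (metis homeomorphic_imp_injective_map topspace_mtopology_of,
        metis homeomorphic_imp_surjective_map topspace_mtopology_of topspace_subtopology)
  then show False
    using starry_quasisymmetric_imp_not_doubling[OF \<open>starry X\<close> _ _ qs] \<open>doubling Y\<close> by blast
qed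

end
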